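(* Let $\alpha,\epsilon,\delta>0$ and set $q:=\left\lceil\frac{32}{\epsilon^2}\log\frac4\alpha\right\rceil$, assumed to be at least $1$. Let $\xi\in\Delta_\Theta$ be a posterior, $\mathcal V=\{\mathcal V_i\}_{i\in\mathcal N}$ distributions of buyers' valuations, and $g,h:[0,1]^n\to[0,1]$ two functions. If $g$ is $(\delta,\alpha,\epsilon)$-stable compared to $h$ for $(\xi,\mathcal V)$, then there exists a probability distribution $\gamma\in\Delta_{\Xi^q}$ over $q$-uniform posteriors such that, for every $\theta\in\Theta$, $$\sum_{\tilde\xi\in\mathrm{supp}(\gamma)}\gamma(\tilde\xi)\,\tilde\xi(\theta)=\xi(\theta)$$ and $$\mathbb E_{\tilde\xi\sim\gamma,\,V\sim\mathcal V}\big[\tilde\xi(\theta)\,g(V\tilde\xi)\big]\ \ge\ \xi(\theta)\Big[(1-\alpha)\,\mathbb E_{V\sim\mathcal V}\big[h(V\xi)\big]-\delta\epsilon\Big].$$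
   Context: $\mathcal N=\{1,\dots,n\}$ is the set of buyers, $\Theta=\{\theta_1,\dots,\theta_d\}$ a finite set of states, $\Delta_X$ the probability simplex over a finite set $X$; elements $\xi\in\Delta_\Theta$ (posteriors) are viewed as column vectors in $\mathbb R^d$. $\mathcal V=\{\mathcal V_i\}_{i\in\mathcal N}$ are probability distributions on $[0,1]^d$; $V\sim\mathcal V$ denotes a random matrix $V\in[0,1]^{n\times d}$ whose rows $V_i$ are drawn independently, with $V_i^\top\sim\mathcal V_i$. A posterior is $q$-uniform ($q\in\mathbb N_{>0}$) if it is the average of a multiset of $q$ canonical basis vectors of $\mathbb R^d$; $\Xi^q\subset\Delta_\Theta$ is the set of all $q$-uniform posteriors. For $\alpha,\epsilon>0$, a probability distribution $\gamma$ over $\Delta_\Theta$ is $(\alpha,\epsilon)$-decreasing around $\xi\in\Delta_\Theta$ if, for every $V\in[0,1]^{n\times d}$ and every $i\in\mathcal N$, $\Pr_{\tilde\xi\sim\gamma}\{V_i\tilde\xi\ge V_i\xi-\epsilon\}\ge 1-\alpha$. Given $\xi$ and $\mathcal V$, a function $g:[0,1]^n\to[0,1]$ is $(\delta,\alpha,\epsilon)$-stable compared to $h:[0,1]^n\to[0,1]$ for $(\xi,\mathcal V)$ if for every probability distribution $\gamma$ over $\Delta_\Theta$ that is $(\alpha,\epsilon)$-decreasing around $\xi$, $$\mathbb E_{\tilde\xi\sim\gamma,V\sim\mathcal V}[g(V\tilde\xi)]\ge(1-\alpha)\,\mathbb E_{V\sim\mathcal V}[h(V\xi)]-\delta\epsilon.$$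 $\log$ is the natural logarithm. *)

theory Defs
  imports "HOL-Probability.Probability"
begin

text \<open>
  Buyers are indexed by a finite type \<open>'n\<close> and states by a finite type \<open>'d\<close>. Probability
  distributions over a subset \<open>S\<close> of a Euclidean space are Borel probability measures whose
  underlying space is \<open>S\<close> itself, so that the values of functions outside \<open>S\<close> play no role.
\<close>

definition distribution_on :: "'a::topological_space set \<Rightarrow> 'a measure \<Rightarrow> bool" where
  "distribution_on S M \<longleftrightarrow> prob_space M \<and> sets M = sets (restrict_space borel S)"

definition unit_cube :: "(real ^ 'a::finite) set" where
  "unit_cube = {x. \<forall>i. x $ i \<in> {0..1}}"

definition unit_matrices :: "(real ^ 'd::finite ^ 'n::finite) set" where
  "unit_matrices = {V. \<forall>i. V $ i \<in> unit_cube}"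

definition posteriors :: "(real ^ 'd::finite) set" where
  "posteriors = {\<xi>. (\<forall>\<theta>. 0 \<le> \<xi> $ \<theta>) \<and> (\<Sum>\<theta>\<in>UNIV. \<xi> $ \<theta>) = 1}"

definition uniform_posteriors :: "nat \<Rightarrow> (real ^ 'd::finite) set" where
  "uniform_posteriors q =
    {\<xi>. \<exists>B. set_mset B \<subseteq> range (\<lambda>\<theta>. axis \<theta> 1) \<and> size B = q \<and> \<xi> = (1 / real q) *\<^sub>R \<Sum>\<^sub># B}"

text \<open>The law of the matrix whose rows are drawn independently, row \<open>i\<close> from \<open>\<V> i\<close>.\<close>

definition valuation_dist ::
    "('n::finite \<Rightarrow> (real ^ 'd::finite) measure) \<Rightarrow> (real ^ 'd ^ 'n) measure" where
  "valuation_dist \<V> =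
    distr (PiM UNIV \<V>) (restrict_space borel unit_matrices) (\<lambda>rows. \<chi> i. rows i)"

text \<open>The type argument records the number of buyers, that is, the number of rows of \<open>V\<close>.\<close>

definition decreasing_around ::
    "'n::finite itself \<Rightarrow> real \<Rightarrow> real \<Rightarrow> real ^ 'd::finite \<Rightarrow> (real ^ 'd) measure \<Rightarrow> bool" where
  "decreasing_around _ \<alpha> \<epsilon> \<xi> \<gamma> \<longleftrightarrow>
    (\<forall>V \<in> (unit_matrices :: (real ^ 'd ^ 'n) set). \<forall>i.
      measure \<gamma> {\<xi>' \<in> space \<gamma>. (V *v \<xi>') $ i \<ge> (V *v \<xi>) $ i - \<epsilon>} \<ge> 1 - \<alpha>)"

definition stable_compared ::
    "real \<Rightarrow> real \<Rightarrow> real \<Rightarrow> real ^ 'd::finite \<Rightarrow> ('n::finite \<Rightarrow> (real ^ 'd) measure) \<Rightarrow>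
      (real ^ 'n \<Rightarrow> real) \<Rightarrow> (real ^ 'n \<Rightarrow> real) \<Rightarrow> bool" where
  "stable_compared \<delta> \<alpha> \<epsilon> \<xi> \<V> g h \<longleftrightarrow>
    (\<forall>\<gamma>. distribution_on posteriors \<gamma> \<and> decreasing_around TYPE('n) \<alpha> \<epsilon> \<xi> \<gamma> \<longrightarrow>
      (\<integral>(\<xi>', V). g (V *v \<xi>') \<partial>(\<gamma> \<Otimes>\<^sub>M valuation_dist \<V>))
        \<ge> (1 - \<alpha>) * (\<integral>V. h (V *v \<xi>) \<partial>valuation_dist \<V>) - \<delta> * \<epsilon>)"

end

theory Submission
  imports Defs
begin

text \<open>
  Take for \<open>\<gamma>\<close> the law of the empirical distribution of \<open>q\<close> independent states
  \<open>s 0, \<dots>, s (q - 1)\<close> drawn from \<open>\<xi>\<close>. The factor \<open>\<xi>' $ \<theta>\<close> is the average of the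
  indicators of \<open>s j = \<theta>\<close>, and weighting by such an indicator amounts to conditioning on
  \<open>s j = \<theta>\<close>, i.e. to multiplying by \<open>\<xi> $ \<theta>\<close> and overwriting the \<open>j\<close>-th sample by \<open>\<theta>\<close>.
  Overwriting one sample moves \<open>V\<^sub>i \<xi>'\<close> by at most \<open>1 / q\<close>, so by Hoeffding's inequality the
  conditioned law is still \<open>(\<alpha>, \<epsilon>)\<close>-decreasing around \<open>\<xi>\<close>, and stability applies to it.
\<close>

section \<open>Empirical distributions as uniform posteriors\<close>

definition empirical :: "nat \<Rightarrow> (nat \<Rightarrow> 'd::finite) \<Rightarrow> real ^ 'd" where
  "empirical q s = (1 / real q) *\<^sub>R (\<Sum>j<q. axis (s j) 1)"

lemma empirical_nth: "empirical q s $ \<theta> = (\<Sum>j<q. of_bool (s j = \<theta>)) / real q"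
  by (simp add: empirical_def axis_def of_bool_def eq_commute)

lemma matrix_vector_mult_axis: "((V :: real ^ 'd::finite ^ 'n::finite) *v axis \<theta> 1) $ i = V $ i $ \<theta>"
  by (simp add: matrix_vector_mult_basis column_def)

lemma matrix_vector_mult_empirical:
  fixes V :: "real ^ 'd::finite ^ 'n::finite"
  shows "(V *v empirical q s) $ i = (\<Sum>j<q. V $ i $ s j) / real q"
  by (simp add: empirical_def matrix_vector_mult_scaleR Real_Vector_Spaces.linear_sum[OF matrix_vector_mul_linear]
      matrix_vector_mult_axis)

lemma empirical_in_uniform_posteriors: "empirical q s \<in> uniform_posteriors q"
proof -
  \<comment> \<open>A multiset keeps repeated samples, so its size is \<open>q\<close> even when
    states coincide.\<close>
  let ?B = "image_mset (\<lambda>j. axis (s j) (1 :: real)) (mset_set {..<q})"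
  have "set_mset ?B \<subseteq> range (\<lambda>\<theta>. axis \<theta> 1)" "size ?B = q" "empirical q s = (1 / real q) *\<^sub>R \<Sum>\<^sub># ?B"
    by (auto simp: empirical_def sum_unfold_sum_mset)
  then show ?thesis
    unfolding uniform_posteriors_def by blast
qed

lemma uniform_posteriors_subset_posteriors:
  assumes "q \<ge> 1"
  shows "(uniform_posteriors q :: (real ^ 'd::finite) set) \<subseteq> posteriors"
proof
  fix \<xi> :: "real ^ 'd"
  assume "\<xi> \<in> uniform_posteriors q"
  then obtain B where B: "set_mset B \<subseteq> range (\<lambda>\<theta>. axis \<theta> 1)" "size B = q"
    "\<xi> = (1 / real q) *\<^sub>R \<Sum>\<^sub># B"
    unfolding uniform_posteriors_def by blast
  \<comment> \<open>Each basis vector adds total mass 1 and no negative entry, so the unnormalized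
    sum has mass \<open>size B\<close>; dividing by \<open>q \<ge> 1\<close> then gives mass
    1.\<close>
  have "(\<forall>\<theta>. 0 \<le> (\<Sum>\<^sub># B) $ \<theta>) \<and> (\<Sum>\<theta>\<in>UNIV. (\<Sum>\<^sub># B) $ \<theta>) = real (size B)"
    using B(1)
    by (induction B) (auto simp: axis_def sum.distrib)
  with B assms show "\<xi> \<in> posteriors"
    by (auto simp: posteriors_def sum_divide_distrib[symmetric])
qed

lemma empirical_in_posteriors: "q \<ge> 1 \<Longrightarrow> empirical q s \<in> posteriors"
  using empirical_in_uniform_posteriors uniform_posteriors_subset_posteriors by blast

text \<open>Each coordinate is a convex combination of entries in [0,1]. This keeps the arguments of
  \<open>g\<close> inside the cube, the only place where \<open>g\<close> is known to be bounded and
  measurable.\<close>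

lemma matrix_vector_mult_in_unit_cube:
  fixes V :: "real ^ 'd::finite ^ 'n::finite"
  assumes "V \<in> unit_matrices" "\<xi> \<in> posteriors"
  shows "V *v \<xi> \<in> unit_cube"
proof -
  have "(V *v \<xi>) $ i \<in> {0..1}" for i
  proof -
    have V: "0 \<le> V $ i $ \<theta>" "V $ i $ \<theta> \<le> 1" for \<theta>
      using assms by (auto simp: unit_matrices_def unit_cube_def)
    have \<xi>: "0 \<le> \<xi> $ \<theta>" for \<theta>
      using assms by (auto simp: posteriors_def)
    have "(V *v \<xi>) $ i \<le> (\<Sum>\<theta>\<in>UNIV. \<xi> $ \<theta>)"
      unfolding matrix_vector_mult_def using V \<xi>
      by (auto intro!: sum_mono mult_left_le_one_le)
    moreover have "0 \<le> (V *v \<xi>) $ i"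
      unfolding matrix_vector_mult_def using V \<xi> by (auto intro!: sum_nonneg)
    ultimately show ?thesis
      using assms by (auto simp: posteriors_def)
  qed
  then show ?thesis
    by (simp add: unit_cube_def)
qed

section \<open>Independent samples: conditioning on one coordinate, and concentration\<close>

lemma finite_set_Pi_pmf:
  fixes p :: "'d::finite pmf"
  shows "finite A \<Longrightarrow> finite (set_pmf (Pi_pmf A c (\<lambda>_. p)))"
  by (simp add: set_Pi_pmf finite_PiE_dflt)

text \<open>By independence, \<open>s\<close> can be sampled by drawing the coordinates other than
  \<open>j\<close> and then writing a fresh draw \<open>y\<close> from \<open>p\<close> at
  \<open>j\<close>. The indicator keeps only \<open>y = \<theta>\<close>, which has mass
  \<open>pmf p \<theta>\<close>.\<close>

lemma expectation_Pi_pmf_condition: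
  fixes p :: "'d::finite pmf" and F :: "('a \<Rightarrow> 'd) \<Rightarrow> real"
  assumes "finite A" "j \<in> A"
  shows "measure_pmf.expectation (Pi_pmf A c (\<lambda>_. p)) (\<lambda>s. of_bool (s j = \<theta>) * F s) =
    pmf p \<theta> * measure_pmf.expectation (Pi_pmf A c (\<lambda>_. p)) (\<lambda>s. F (s(j := \<theta>)))"
proof -
  define P where "P = Pi_pmf (A - {j}) c (\<lambda>_. p)"
  have fin: "finite (set_pmf P)"
    using assms by (simp add: P_def finite_set_Pi_pmf)
  have eq: "Pi_pmf A c (\<lambda>_. p) = bind_pmf p (\<lambda>y. map_pmf (\<lambda>s. s(j := y)) P)"
    using Pi_pmf_insert'[of "A - {j}" j c "\<lambda>_. p"] assms
    by (simp add: insert_absorb P_def map_pmf_def)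
  have E: "measure_pmf.expectation (Pi_pmf A c (\<lambda>_. p)) H =
      (\<Sum>y\<in>UNIV. pmf p y * measure_pmf.expectation P (\<lambda>s. H (s(j := y))))" for H :: "('a \<Rightarrow> 'd) \<Rightarrow> real"
    unfolding eq by (subst pmf_expectation_bind[where A = UNIV]) (auto simp: fin)
  have "(\<Sum>y\<in>UNIV. pmf p y * measure_pmf.expectation P (\<lambda>s. of_bool (y = \<theta>) * F (s(j := y)))) =
      (\<Sum>y\<in>UNIV. if y = \<theta> then pmf p \<theta> * measure_pmf.expectation P (\<lambda>s. F (s(j := \<theta>))) else 0)"
    by (intro sum.cong) auto
  \<comment> \<open>On the right-hand side coordinate \<open>j\<close> is overwritten anyway, so
    summing out \<open>y\<close> contributes the factor 1.\<close>
  moreover have "(\<Sum>y\<in>UNIV. pmf p y) = 1"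
    by (simp add: sum_pmf_eq_1)
  ultimately show ?thesis
    unfolding E by (simp add: sum_distrib_right[symmetric])
qed

text \<open>The overwritten sum is at least the original sum minus 1. A deviation by
  \<open>q * \<epsilon>\<close> after overwriting thus forces a deviation by
  \<open>q * \<epsilon> - 1\<close> before it, where the summands are independent and Hoeffding's
  inequality applies.\<close>

lemma prob_average_less:
  fixes p :: "'d::finite pmf" and v :: "'d \<Rightarrow> real" and q j :: nat and \<epsilon> :: real
  assumes v: "\<And>\<theta>. v \<theta> \<in> {0..1}" and q: "q \<ge> 1" and \<epsilon>: "real q * \<epsilon> \<ge> 1" and j: "j < q"
  shows "measure (Pi_pmf {..<q} c (\<lambda>_. p))
      {s. (\<Sum>k<q. v ((s(j := \<theta>)) k)) / real q < measure_pmf.expectation p v - \<epsilon>}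
    \<le> exp (- 2 * (real q * \<epsilon> - 1)\<^sup>2 / real q)"
proof -
  let ?P = "Pi_pmf {..<q} c (\<lambda>_. p)"
  have mean: "measure_pmf.expectation ?P (\<lambda>s. v (s k)) = measure_pmf.expectation p v"
    if "k < q" for k
  proof -
    have "map_pmf (\<lambda>s. s k) ?P = p"
      using that by (simp add: Pi_pmf_component)
    then show ?thesis
      using integral_map_pmf[of "\<lambda>s. s k" ?P v] by simp
  qed
  have "prob_space.indep_vars ?P (\<lambda>_. borel) (\<lambda>k s. v (s k)) {..<q}"
    using prob_space.indep_vars_compose2[OF _ indep_vars_Pi_pmf, of "{..<q}" _ _ "\<lambda>_. v" "\<lambda>_. borel"]
    by (simp add: measure_pmf.prob_space_axioms)
  then interpret Hoeffding_ineq "measure_pmf ?P" "{..<q}" "\<lambda>k s. v (s k)" "\<lambda>_. 0" "\<lambda>_. 1"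
    "\<Sum>k<q. measure_pmf.expectation ?P (\<lambda>s. v (s k))"
    using v by unfold_locales auto
  \<comment> \<open>The two sums differ only in the term at \<open>j\<close>, whose values both lie
    in [0,1].\<close>
  have change: "(\<Sum>k<q. v ((s(j := \<theta>)) k)) \<ge> (\<Sum>k<q. v (s k)) - 1" for s
  proof -
    have "(\<Sum>k<q. v ((s(j := \<theta>)) k)) = v \<theta> + (\<Sum>k\<in>{..<q} - {j}. v (s k))"
      using j by (subst sum.remove[of _ j]) auto
    moreover have "(\<Sum>k<q. v (s k)) = v (s j) + (\<Sum>k\<in>{..<q} - {j}. v (s k))"
      using j by (subst sum.remove[of _ j]) auto
    ultimately show ?thesis
      using v[of \<theta>] v[of "s j"] by simp
  qed
  have "measure ?P {s. (\<Sum>k<q. v ((s(j := \<theta>)) k)) / real q < measure_pmf.expectation p v - \<epsilon>}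
    \<le> measure ?P {s \<in> space ?P. (\<Sum>k<q. v (s k)) \<le>
        (\<Sum>k<q. measure_pmf.expectation ?P (\<lambda>s. v (s k))) - (real q * \<epsilon> - 1)}"
  proof (intro measure_pmf.finite_measure_mono, safe)
    fix s
    assume "(\<Sum>k<q. v ((s(j := \<theta>)) k)) / real q < measure_pmf.expectation p v - \<epsilon>"
    then have "(\<Sum>k<q. v ((s(j := \<theta>)) k)) < real q * measure_pmf.expectation p v - real q * \<epsilon>"
      using q by (simp add: field_simps)
    with change[of s] show "(\<Sum>k<q. v (s k)) \<le>
        (\<Sum>k<q. measure_pmf.expectation ?P (\<lambda>s. v (s k))) - (real q * \<epsilon> - 1)"
      by (simp add: mean)
  qed auto
  \<comment> \<open>The \<open>q\<close> summands range over intervals of length 1, so the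
    denominator in Hoeffding's bound is \<open>q\<close>; the deviation is nonnegative by
    \<open>\<epsilon>\<close>.\<close>
  also have "\<dots> \<le> exp (- 2 * (real q * \<epsilon> - 1)\<^sup>2 / real q)"
    using Hoeffding_ineq_le[of "real q * \<epsilon> - 1"] q \<epsilon> by simp
  finally show ?thesis .
qed

text \<open>With \<open>L = ln (4 / \<alpha>) \<ge> 1\<close>, the size of \<open>q\<close> gives
  \<open>q * \<epsilon> \<ge> 32\<close>, so the loss of 1 from overwriting costs at most half of
  \<open>q * \<epsilon>\<close>. The exponent then has absolute value at least
  \<open>q * \<epsilon>\<^sup>2 / 2 \<ge> 16 * L\<close>, which exceeds \<open>L\<close>.\<close>

lemma sample_size_bound:
  fixes \<alpha> \<epsilon> :: real
  assumes \<alpha>: "0 < \<alpha>" "\<alpha> < 1" and \<epsilon>: "0 < \<epsilon>" "\<epsilon> < 1" and q: "real q \<ge> 32 / \<epsilon>\<^sup>2 * ln (4 / \<alpha>)"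
  shows "q * \<epsilon> \<ge> 1" and "exp (- 2 * (q * \<epsilon> - 1)\<^sup>2 / q) \<le> \<alpha>"
proof -
  define L where "L = ln (4 / \<alpha>)"
  have "exp 1 \<le> 4 / \<alpha>"
  proof -
    have "exp (1::real) \<le> 4" using exp_le by simp
    also have "4 \<le> 4 / \<alpha>" using \<alpha> by (simp add: field_simps)
    finally show ?thesis .
  qed
  then have L: "L \<ge> 1"
    unfolding L_def using \<alpha> by (subst ln_ge_iff) auto
  have qe: "q * \<epsilon>\<^sup>2 \<ge> 32 * L"
    using q \<epsilon> by (simp add: L_def field_simps)
  \<comment> \<open>Here \<open>\<epsilon> < 1\<close> turns the bound on
    \<open>q * \<epsilon>\<^sup>2\<close> into one on \<open>q * \<epsilon>\<close>.\<close>
  have "q * \<epsilon>\<^sup>2 \<le> q * \<epsilon>"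
    using \<epsilon> by (intro mult_left_mono) (auto simp: power2_eq_square)
  with qe L have big: "q * \<epsilon> \<ge> 32" by linarith
  then show "q * \<epsilon> \<ge> 1" by simp
  have q0: "real q > 0"
    using big by (cases "q = 0") auto
  have "(q * \<epsilon> / 2)\<^sup>2 \<le> (q * \<epsilon> - 1)\<^sup>2"
    using big by (intro power_mono) linarith+
  then have "2 * (q * \<epsilon> / 2)\<^sup>2 / q \<le> 2 * (q * \<epsilon> - 1)\<^sup>2 / q"
    using q0 by (intro divide_right_mono) auto
  moreover have "2 * (q * \<epsilon> / 2)\<^sup>2 / q = q * \<epsilon>\<^sup>2 / 2"
    using q0 by (simp add: power2_eq_square field_simps)
  ultimately have "L \<le> 2 * (q * \<epsilon> - 1)\<^sup>2 / q"
    using qe L by linarith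
  then have "exp (- 2 * (q * \<epsilon> - 1)\<^sup>2 / q) \<le> exp (- L)"
    by simp
  also have "\<dots> = \<alpha> / 4"
    using \<alpha> by (simp add: L_def exp_minus)
  finally show "exp (- 2 * (q * \<epsilon> - 1)\<^sup>2 / q) \<le> \<alpha>"
    using \<alpha> by simp
qed

section \<open>Measurability, the law of the valuation matrix, and Fubini\<close>

lemma borel_measurable_matrix_vector_mult [measurable (raw)]:
  fixes A :: "'a \<Rightarrow> real ^ 'd::finite ^ 'n::finite"
  assumes "A \<in> borel_measurable M" "x \<in> borel_measurable M"
  shows "(\<lambda>w. A w *v x w) \<in> borel_measurable M"
proof -
  have "continuous_on UNIV (\<lambda>z :: (real ^ 'd ^ 'n) \<times> (real ^ 'd). fst z *v snd z)"
    unfolding matrix_vector_mult_def by (intro continuous_intros)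
  with assms show ?thesis
    by (rule borel_measurable_continuous_Pair)
qed

lemma borel_measurable_vec_lambda:
  fixes f :: "'i::finite \<Rightarrow> 'a \<Rightarrow> 'b::euclidean_space"
  assumes "\<And>i. f i \<in> borel_measurable M"
  shows "(\<lambda>w. \<chi> i. f i w) \<in> borel_measurable M"
proof (subst borel_measurable_euclidean_space, rule ballI)
  fix b :: "'b ^ 'i"
  assume "b \<in> Basis"
  then obtain i u where "b = axis i u"
    unfolding Basis_vec_def by blast
  moreover have "(\<lambda>w. f i w \<bullet> u) \<in> borel_measurable M"
    using assms by simp
  ultimately show "(\<lambda>w. (\<chi> i. f i w) \<bullet> b) \<in> borel_measurable M"
    by (simp add: inner_axis)
qed

lemma sets_valuation_dist [measurable_cong, simp]:
  "sets (valuation_dist \<V>) = sets (restrict_space borel unit_matrices)"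
  by (simp add: valuation_dist_def)

lemma space_valuation_dist [simp]: "space (valuation_dist \<V>) = unit_matrices"
  by (simp add: valuation_dist_def space_restrict_space)

lemma prob_space_valuation_dist:
  assumes "\<And>i. distribution_on unit_cube (\<V> i)"
  shows "prob_space (valuation_dist \<V>)"
  unfolding valuation_dist_def
proof (rule prob_space.prob_space_distr)
  have sets: "sets (\<V> i) = sets (restrict_space borel unit_cube)" for i
    using assms by (auto simp: distribution_on_def)
  have space: "space (\<V> i) = unit_cube" for i
    using sets_eq_imp_space_eq[OF sets] by (simp add: space_restrict_space)
  show "prob_space (PiM UNIV \<V>)"
    using assms by (auto simp: distribution_on_def intro: prob_space_PiM)
  show "(\<lambda>rows. \<chi> i. rows i) \<in> PiM UNIV \<V> \<rightarrow>\<^sub>M restrict_space borel unit_matrices"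
  \<comment> \<open>Borel measurability is checked row by row; the image lies in
    \<open>unit_matrices\<close> because each \<open>\<V> i\<close> lives on the cube.\<close>
  proof (intro measurable_restrict_space2 borel_measurable_vec_lambda)
    show "(\<lambda>rows. rows i) \<in> borel_measurable (PiM UNIV \<V>)" for i
    proof -
      have "(\<lambda>x. x) \<in> borel_measurable (\<V> i)"
        using measurable_ident_sets[OF sets[of i]] by (simp add: measurable_restrict_space2_iff)
      then show ?thesis
        by (intro measurable_compose[OF measurable_component_singleton[of i UNIV \<V>]]) simp_all
    qed
  qed (auto simp: space_PiM space unit_matrices_def PiE_iff)
qed

lemma borel_measurable_valuation:
  fixes g :: "real ^ 'n::finite \<Rightarrow> real" and X :: "'a \<Rightarrow> real ^ 'd::finite"
  assumes g: "g \<in> borel_measurable (restrict_space borel unit_cube)"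
    and A: "A \<in> M \<rightarrow>\<^sub>M restrict_space borel unit_matrices"
    and X: "X \<in> M \<rightarrow>\<^sub>M restrict_space borel posteriors"
  shows "(\<lambda>w. g (A w *v X w)) \<in> borel_measurable M"
proof -
  have "(\<lambda>w. A w *v X w) \<in> M \<rightarrow>\<^sub>M restrict_space borel unit_cube"
    using A X unfolding measurable_restrict_space2_iff
    by (auto intro!: borel_measurable_matrix_vector_mult matrix_vector_mult_in_unit_cube)
  then show ?thesis
    using g by (rule measurable_compose)
qed

text \<open>Fubini for a bounded integrand on a product of probability spaces. \<open>M\<close> may
  carry more sets than the Borel ones, which covers both the laws fed to stability (with
  \<open>c = 1\<close>) and a restricted pmf (with \<open>c\<close> a coordinate).\<close>

lemma integral_pair_valuation_dist:
  fixes g :: "real ^ 'n::finite \<Rightarrow> real" and c :: "real ^ 'd::finite \<Rightarrow> real"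
  assumes \<V>: "\<And>i. distribution_on unit_cube (\<V> i)"
    and g: "g \<in> unit_cube \<rightarrow> {0..1}" "g \<in> borel_measurable (restrict_space borel unit_cube)"
    and M: "prob_space M" "(\<lambda>x. x) \<in> M \<rightarrow>\<^sub>M restrict_space borel posteriors"
    and c: "c \<in> borel_measurable M" "\<And>x. x \<in> posteriors \<Longrightarrow> c x \<in> {0..1}"
  shows "(\<lambda>x. \<integral>V. g (V *v x) \<partial>valuation_dist \<V>) \<in> borel_measurable M"
    and "(\<integral>(x, V). c x * g (V *v x) \<partial>(M \<Otimes>\<^sub>M valuation_dist \<V>)) =
      (\<integral>x. c x * (\<integral>V. g (V *v x) \<partial>valuation_dist \<V>) \<partial>M)"
proof -
  interpret M: prob_space M by fact
  interpret N: prob_space "valuation_dist \<V>"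
    using \<V> by (rule prob_space_valuation_dist)
  interpret pair_prob_space M "valuation_dist \<V>" ..
  let ?N = "M \<Otimes>\<^sub>M valuation_dist \<V>"
  have space: "x \<in> posteriors" if "x \<in> space M" for x
    using M(2) that by (auto simp: measurable_restrict_space2_iff)
  have "fst \<in> ?N \<rightarrow>\<^sub>M restrict_space borel posteriors"
    using measurable_compose[OF measurable_fst M(2), of "valuation_dist \<V>"] by simp
  moreover have "snd \<in> ?N \<rightarrow>\<^sub>M restrict_space borel unit_matrices"
    by measurable
  ultimately have meas: "(\<lambda>z. g (snd z *v fst z)) \<in> borel_measurable ?N"
    by (intro borel_measurable_valuation g)
  then have "(\<lambda>(x, V). g (V *v x)) \<in> borel_measurable ?N"
    by (simp add: case_prod_unfold)
  then show "(\<lambda>x. \<integral>V. g (V *v x) \<partial>valuation_dist \<V>) \<in> borel_measurable M"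
    by (rule N.borel_measurable_lebesgue_integral)
  have "integrable ?N (\<lambda>z. c (fst z) * g (snd z *v fst z))"
  proof (rule integrable_const_bound[where B = 1])
    have "norm (c (fst z) * g (snd z *v fst z)) \<le> 1" if "z \<in> space ?N" for z
    proof -
      have *: "fst z \<in> posteriors" "snd z \<in> unit_matrices"
        using that by (auto simp: space_pair_measure space)
      then have "g (snd z *v fst z) \<in> {0..1}"
        using g(1) matrix_vector_mult_in_unit_cube by blast
      with c(2)[OF *(1)] show ?thesis
        by (auto simp: abs_mult intro: mult_le_one)
    qed
    then show "AE z in ?N. norm (c (fst z) * g (snd z *v fst z)) \<le> 1"
      by (intro AE_I2)
    show "(\<lambda>z. c (fst z) * g (snd z *v fst z)) \<in> borel_measurable ?N"
      by (intro borel_measurable_times meas measurable_compose[OF measurable_fst c(1)])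
  qed
  from integral_fst'[OF this]
  show "(\<integral>(x, V). c x * g (V *v x) \<partial>?N) = (\<integral>x. c x * (\<integral>V. g (V *v x) \<partial>valuation_dist \<V>) \<partial>M)"
    by (simp add: case_prod_unfold)
qed

section \<open>Laws of empirical posteriors with one sample fixed\<close>

lemma distribution_on_distr_posteriors:
  fixes X :: "'a \<Rightarrow> real ^ 'd::finite" and P :: "'a pmf"
  assumes "range X \<subseteq> posteriors"
  shows "distribution_on posteriors (distr (measure_pmf P) (restrict_space borel posteriors) X)"
proof -
  have "prob_space (distr (measure_pmf P) (restrict_space borel posteriors) X)"
    using assms by (intro measure_pmf.prob_space_distr measurable_restrict_space2) auto
  then show ?thesis
    by (simp add: distribution_on_def)
qed

text \<open>For fixed \<open>V\<close> and \<open>i\<close>, the \<open>i\<close>-th coordinate of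
  \<open>V *v \<xi>\<close> is the mean of \<open>V $ i $ \<theta>\<close> under \<open>p\<close>,
  and at an empirical posterior it is the sample average. Concentration with one sample overwritten
  bounds the failure probability by \<open>\<alpha>\<close>.\<close>

lemma decreasing_around_empirical:
  fixes \<xi> :: "real ^ 'd::finite"
  assumes \<alpha>: "\<alpha> > 0" and \<epsilon>: "\<epsilon> > 0"
    and q: "q = nat \<lceil>32 / \<epsilon>\<^sup>2 * ln (4 / \<alpha>)\<rceil>" "q \<ge> 1" and \<xi>: "\<xi> \<in> posteriors"
    and p: "\<And>\<theta>. pmf p \<theta> = \<xi> $ \<theta>" and j: "j < q"
  shows "decreasing_around TYPE('n::finite) \<alpha> \<epsilon> \<xi>
    (distr (measure_pmf (Pi_pmf {..<q} c (\<lambda>_. p))) (restrict_space borel posteriors)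
      (\<lambda>s. empirical q (s(j := \<theta>))))"
  unfolding decreasing_around_def
proof safe
  fix V :: "real ^ 'd ^ 'n" and i :: 'n
  assume V: "V \<in> unit_matrices"
  let ?P = "Pi_pmf {..<q} c (\<lambda>_. p)"
  let ?X = "\<lambda>s. empirical q (s(j := \<theta>))"
  let ?S = "restrict_space borel posteriors :: (real ^ 'd) measure"
  have X: "?X \<in> measure_pmf ?P \<rightarrow>\<^sub>M ?S"
    using empirical_in_posteriors[OF q(2)] by (intro measurable_restrict_space2) auto
  have mean: "(V *v \<xi>) $ i = measure_pmf.expectation p (\<lambda>\<theta>. V $ i $ \<theta>)"
    by (subst integral_measure_pmf_real[of UNIV]) (auto simp: p matrix_vector_mult_def)
  have v: "V $ i $ \<theta> \<in> {0..1}" for \<theta>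
    using V by (auto simp: unit_matrices_def unit_cube_def)
  \<comment> \<open>The event is a closed half-space, hence measurable, so its measure can be pulled
    back to the samples.\<close>
  have set: "{x \<in> space ?S. (V *v x) $ i \<ge> (V *v \<xi>) $ i - \<epsilon>} \<in> sets ?S"
  proof -
    have "closed {x. (V *v x) $ i \<ge> (V *v \<xi>) $ i - \<epsilon>}"
      by (intro closed_Collect_le continuous_intros)
    then have "{x. (V *v x) $ i \<ge> (V *v \<xi>) $ i - \<epsilon>} \<in> sets borel"
      by simp
    then show ?thesis
      by (auto simp: sets_restrict_space space_restrict_space)
  qed
  define bad where "bad = {s. (V *v ?X s) $ i < (V *v \<xi>) $ i - \<epsilon>}"
  have "measure ?P bad \<le> \<alpha>"
  proof (cases "\<alpha> \<ge> 1 \<or> \<epsilon> \<ge> 1") \<comment> \<open>if \<open>True\<close>, then \<open>q\<close> need not be large enough for Hoeffding\<close>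
    case True
    \<comment> \<open>Both coordinates lie in [0,1], so a drop by more than 1 is impossible. In the
      remaining case \<open>\<alpha> \<ge> 1\<close> bounds any probability.\<close>
    have "bad = {}" if "\<epsilon> \<ge> 1"
    proof -
      have "(V *v ?X s) $ i \<ge> 0" "(V *v \<xi>) $ i \<le> 1" for s
        using matrix_vector_mult_in_unit_cube[OF V] empirical_in_posteriors[OF q(2)] \<xi>
        by (auto simp: unit_cube_def)
      with that show ?thesis
        unfolding bad_def by (smt (verit) Collect_empty_eq)
    qed
    with True \<alpha> measure_pmf.prob_le_1[of ?P bad] show ?thesis
      by (cases "\<epsilon> \<ge> 1") (simp, linarith)
  next
    case False
    then have less: "\<alpha> < 1" "\<epsilon> < 1"
      by auto
    have "real q \<ge> 32 / \<epsilon>\<^sup>2 * ln (4 / \<alpha>)"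
      using q(1) real_nat_ceiling_ge by blast
    note size = sample_size_bound[OF \<alpha> less(1) \<epsilon> less(2) this]
    have "measure ?P bad \<le> exp (- 2 * (real q * \<epsilon> - 1)\<^sup>2 / real q)"
      unfolding bad_def matrix_vector_mult_empirical mean
      by (rule prob_average_less[OF v q(2) size(1) j])
    also have "\<dots> \<le> \<alpha>"
      by (rule size(2))
    finally show ?thesis .
  qed
  moreover have "measure ?P (- bad) = 1 - measure ?P bad"
    using measure_pmf.prob_compl[of bad ?P] by (simp add: Compl_eq_Diff_UNIV)
  moreover have "measure (distr (measure_pmf ?P) ?S ?X) {x \<in> space ?S. (V *v x) $ i \<ge> (V *v \<xi>) $ i - \<epsilon>}
      = measure ?P (- bad)"
    unfolding measure_distr[OF X set]
    using empirical_in_posteriors[OF q(2)]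
    by (intro arg_cong[where f = "measure ?P"]) (auto simp: bad_def space_restrict_space)
  ultimately show "1 - \<alpha> \<le> measure (distr (measure_pmf ?P) ?S ?X)
      {x \<in> space (distr (measure_pmf ?P) ?S ?X). (V *v x) $ i \<ge> (V *v \<xi>) $ i - \<epsilon>}"
    by simp
qed

section \<open>Coordinate-weighted expectations and the final construction\<close>

text \<open>The coordinate at \<open>\<theta>\<close> is the average of \<open>q\<close> indicators;
  linearity splits the expectation, and conditioning replaces each indicator by the factor
  \<open>pmf p \<theta>\<close>.\<close>

lemma expectation_empirical:
  fixes p :: "'d::finite pmf" and F :: "real ^ 'd \<Rightarrow> real"
  shows "measure_pmf.expectation (Pi_pmf {..<q} c (\<lambda>_. p)) (\<lambda>s. empirical q s $ \<theta> * F (empirical q s)) =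
    pmf p \<theta> * ((\<Sum>j<q. measure_pmf.expectation (Pi_pmf {..<q} c (\<lambda>_. p))
      (\<lambda>s. F (empirical q (s(j := \<theta>))))) / q)"
proof -
  let ?P = "Pi_pmf {..<q} c (\<lambda>_. p)"
  have "measure_pmf.expectation ?P (\<lambda>s. empirical q s $ \<theta> * F (empirical q s)) =
      measure_pmf.expectation ?P (\<lambda>s. (\<Sum>j<q. of_bool (s j = \<theta>) * F (empirical q s)) / q)"
    by (simp add: empirical_nth sum_distrib_right)
  also have "\<dots> = (\<Sum>j<q. measure_pmf.expectation ?P (\<lambda>s. of_bool (s j = \<theta>) * F (empirical q s))) / q"
    by (subst integral_divide_zero, subst Bochner_Integration.integral_sum)
      (rule refl integrable_measure_pmf_finite finite_set_Pi_pmf finite_lessThan)+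
  also have "\<dots> = pmf p \<theta> * ((\<Sum>j<q. measure_pmf.expectation ?P
      (\<lambda>s. F (empirical q (s(j := \<theta>))))) / q)"
    by (simp add: expectation_Pi_pmf_condition sum_distrib_left)
  finally show ?thesis .
qed

theorem theorem2:
  fixes \<alpha> \<epsilon> \<delta> :: real
    and q :: nat
    and \<xi> :: "real ^ 'd::finite"
    and \<V> :: "'n::finite \<Rightarrow> (real ^ 'd) measure"
    and g h :: "real ^ 'n \<Rightarrow> real"
  assumes "\<alpha> > 0" and "\<epsilon> > 0" and "\<delta> > 0"
    and "q = nat \<lceil>32 / \<epsilon>\<^sup>2 * ln (4 / \<alpha>)\<rceil>" and "q \<ge> 1"
    and "\<xi> \<in> posteriors"
    and "\<And>i. distribution_on unit_cube (\<V> i)"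
    and "g \<in> unit_cube \<rightarrow> {0..1}" and "g \<in> borel_measurable (restrict_space borel unit_cube)"
    and "h \<in> unit_cube \<rightarrow> {0..1}" and "h \<in> borel_measurable (restrict_space borel unit_cube)"
    and "stable_compared \<delta> \<alpha> \<epsilon> \<xi> \<V> g h"
  shows "\<exists>\<gamma> :: (real ^ 'd) pmf. set_pmf \<gamma> \<subseteq> uniform_posteriors q \<and>
    (\<forall>\<theta>. (\<Sum>\<xi>'\<in>set_pmf \<gamma>. pmf \<gamma> \<xi>' * \<xi>' $ \<theta>) = \<xi> $ \<theta> \<and>
      (\<integral>(\<xi>', V). \<xi>' $ \<theta> * g (V *v \<xi>')
          \<partial>(restrict_space (measure_pmf \<gamma>) (uniform_posteriors q) \<Otimes>\<^sub>M valuation_dist \<V>))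
        \<ge> \<xi> $ \<theta> * ((1 - \<alpha>) * (\<integral>V. h (V *v \<xi>) \<partial>valuation_dist \<V>) - \<delta> * \<epsilon>))"
proof -
  note \<V> = assms(7) and g = assms(8,9)
  define p where "p = embed_pmf (\<lambda>\<theta>. \<xi> $ \<theta>)"
  have p: "pmf p \<theta> = \<xi> $ \<theta>" for \<theta>
    unfolding p_def
  proof (rule pmf_embed_pmf)
    show "0 \<le> \<xi> $ \<theta>" for \<theta>
      using assms(6) by (simp add: posteriors_def)
    then show "(\<integral>\<^sup>+\<theta>. ennreal (\<xi> $ \<theta>) \<partial>count_space UNIV) = 1"
      using assms(6) by (simp add: nn_integral_count_space_finite posteriors_def)
  qed
  \<comment> \<open>Indices below \<open>q\<close> are the only ones that \<open>empirical q\<close>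
    reads; elsewhere samples take the default \<open>undefined\<close>.\<close>
  define P where "P = Pi_pmf {..<q} undefined (\<lambda>_. p)"
  define \<gamma> where "\<gamma> = map_pmf (empirical q) P"
  \<comment> \<open>Integrating out \<open>V\<close> first reduces both sides to expectations over
    the samples; \<open>R\<close> is the lower bound supplied by stability.\<close>
  define G where "G x = (\<integral>V. g (V *v x) \<partial>valuation_dist \<V>)" for x
  define R where "R = (1 - \<alpha>) * (\<integral>V. h (V *v \<xi>) \<partial>valuation_dist \<V>) - \<delta> * \<epsilon>"
  have set_\<gamma>: "set_pmf \<gamma> \<subseteq> uniform_posteriors q"
    by (auto simp: \<gamma>_def empirical_in_uniform_posteriors)
  have fin: "finite (set_pmf \<gamma>)"
    by (simp add: \<gamma>_def P_def finite_set_Pi_pmf)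
  \<comment> \<open>Stability is applied not to \<open>\<gamma>\<close> but to its law conditioned
    on sample \<open>j\<close> being \<open>\<theta>\<close>, once for each \<open>j\<close> and
    \<open>\<theta>\<close>.\<close>
  have stable: "R \<le> measure_pmf.expectation P (\<lambda>s. G (empirical q (s(j := \<theta>))))"
    if j: "j < q" for j \<theta>
  proof -
    let ?X = "\<lambda>s. empirical q (s(j := \<theta>))"
    let ?S = "restrict_space borel posteriors :: (real ^ 'd) measure"
    let ?M = "distr (measure_pmf P) ?S ?X"
    have X: "?X \<in> measure_pmf P \<rightarrow>\<^sub>M ?S"
      using empirical_in_posteriors[OF assms(5)] by (intro measurable_restrict_space2) auto
    have dist: "distribution_on posteriors ?M"
      using empirical_in_posteriors[OF assms(5)] by (intro distribution_on_distr_posteriors) auto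
    have "decreasing_around TYPE('n) \<alpha> \<epsilon> \<xi> ?M"
      unfolding P_def by (intro decreasing_around_empirical assms p j)
    with dist assms(12) have "R \<le> (\<integral>(x, V). g (V *v x) \<partial>(?M \<Otimes>\<^sub>M valuation_dist \<V>))"
      unfolding stable_compared_def R_def by blast
    also have "\<dots> = (\<integral>x. G x \<partial>?M)"
      using integral_pair_valuation_dist(2)[OF \<V> g, of ?M "\<lambda>_. 1"] dist
      by (simp add: G_def distribution_on_def)
    also have "\<dots> = measure_pmf.expectation P (\<lambda>s. G (?X s))"
    proof (rule integral_distr[OF X])
      show "G \<in> borel_measurable ?S"
        using integral_pair_valuation_dist(1)[OF \<V> g, of ?M "\<lambda>_. 1"] dist
        by (simp add: G_def[abs_def] distribution_on_def)
    qed
    finally show ?thesis .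
  qed
  have "(\<Sum>\<xi>'\<in>set_pmf \<gamma>. pmf \<gamma> \<xi>' * \<xi>' $ \<theta>) = \<xi> $ \<theta>" for \<theta>
  proof -
    have "(\<Sum>\<xi>'\<in>set_pmf \<gamma>. pmf \<gamma> \<xi>' * \<xi>' $ \<theta>) = measure_pmf.expectation \<gamma> (\<lambda>x. x $ \<theta>)"
      by (subst integral_measure_pmf[OF fin]) auto
    also have "\<dots> = measure_pmf.expectation P (\<lambda>s. empirical q s $ \<theta>)"
      by (simp add: \<gamma>_def)
    \<comment> \<open>With the constant function 1, the average over \<open>j\<close> of the
      conditional expectations is 1.\<close>
    also have "\<dots> = \<xi> $ \<theta>"
      using expectation_empirical[of q undefined p \<theta> "\<lambda>_. 1"] assms(5) by (simp add: P_def p)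
    finally show ?thesis .
  qed
  moreover have "\<xi> $ \<theta> * R \<le> (\<integral>(\<xi>', V). \<xi>' $ \<theta> * g (V *v \<xi>')
      \<partial>(restrict_space (measure_pmf \<gamma>) (uniform_posteriors q) \<Otimes>\<^sub>M valuation_dist \<V>))" for \<theta>
  proof -
    let ?M = "restrict_space (measure_pmf \<gamma>) (uniform_posteriors q)"
    \<comment> \<open>The uniform posteriors have full mass under \<open>\<gamma>\<close>, so
      restricting to them keeps a probability measure and, later, the value of the integral.\<close>
    have "measure \<gamma> (uniform_posteriors q) = 1"
      using set_\<gamma> by (simp add: measure_pmf.prob_eq_1 AE_measure_pmf_iff subset_iff)
    then have M: "prob_space ?M"
      by (intro prob_space_restrict_space) (auto simp: measure_pmf.emeasure_eq_measure)
    have id: "(\<lambda>x. x) \<in> ?M \<rightarrow>\<^sub>M restrict_space borel posteriors"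
      using uniform_posteriors_subset_posteriors[OF assms(5)]
      by (intro measurable_restrict_space2 measurable_restrict_space1) (auto simp: space_restrict_space)
    have coord: "x $ \<theta> \<in> {0..1}" if "x \<in> posteriors" for x :: "real ^ 'd"
      using that member_le_sum[of \<theta> UNIV "($) x"] by (auto simp: posteriors_def)
    \<comment> \<open>Averaging the \<open>q\<close> stability bounds keeps the bound
      \<open>R\<close>; multiplying by \<open>\<xi> $ \<theta> \<ge> 0\<close> then undoes the
      conditioning.\<close>
    have "R \<le> (\<Sum>j<q. measure_pmf.expectation P (\<lambda>s. G (empirical q (s(j := \<theta>))))) / q"
      using sum_mono[of "{..<q}" "\<lambda>_. R", OF stable] assms(5) by (simp add: field_simps)
    then have "\<xi> $ \<theta> * R \<le>
        measure_pmf.expectation P (\<lambda>s. empirical q s $ \<theta> * G (empirical q s))"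
      unfolding P_def expectation_empirical p[symmetric] by (intro mult_left_mono pmf_nonneg)
    also have "\<dots> = (\<integral>x. x $ \<theta> * G x \<partial>\<gamma>)"
      by (simp add: \<gamma>_def)
    also have "\<dots> = (\<integral>x. x $ \<theta> * G x \<partial>?M)"
      using set_\<gamma>
      by (subst integral_restrict_space) (auto intro!: integral_cong_AE simp: AE_measure_pmf_iff subset_iff)
    also have "\<dots> = (\<integral>(\<xi>', V). \<xi>' $ \<theta> * g (V *v \<xi>') \<partial>(?M \<Otimes>\<^sub>M valuation_dist \<V>))"
      unfolding G_def
      by (rule integral_pair_valuation_dist(2)[OF \<V> g M id, symmetric])
        (use coord in \<open>auto intro!: measurable_restrict_space1\<close>)
    finally show ?thesis .
  qed
  ultimately show ?thesis
    using set_\<gamma> unfolding R_def by blast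
qed

end
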